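(* Let $C(k)$ be defined as in the context. Then $C(k)=\Omega(k\log k)$; that is, there is an absolute constant $c>0$ such that $C(k)\ge c\,k\log k$ for all sufficiently large $k$.
   Context: All graphs are finite, simple and undirected. The repetition number of a graph is the maximum number of its vertices having the same degree. For a positive integer $k$, $C(k)$ denotes the least integer $C$ such that every graph with $n$ vertices (for every $n$) has an induced subgraph with at least $n-C$ vertices whose repetition number is at least $\min\{k,n-C\}$ (degrees computed in the induced subgraph). *)

theory Defs
  imports Complex_Main
begin

definition simple_graph :: "'a set \<Rightarrow> ('a \<Rightarrow> 'a \<Rightarrow> bool) \<Rightarrow> bool" where
  "simple_graph V E \<longleftrightarrow>
     finite V \<and> (\<forall>u v. E u v \<longrightarrow> u \<in> V \<and> v \<in> V) \<and> symp E \<and> irreflp E"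

definition induced :: "('a \<Rightarrow> 'a \<Rightarrow> bool) \<Rightarrow> 'a set \<Rightarrow> 'a \<Rightarrow> 'a \<Rightarrow> bool" where
  "induced E W u v \<longleftrightarrow> u \<in> W \<and> v \<in> W \<and> E u v"

definition vertex_degree :: "'a set \<Rightarrow> ('a \<Rightarrow> 'a \<Rightarrow> bool) \<Rightarrow> 'a \<Rightarrow> nat" where
  "vertex_degree V E v = card {u \<in> V. E v u}"

text \<open>
  For finite \<open>V\<close> the maximum is over a finite set of values; the empty graph
  has repetition number 0.
\<close>

definition repetition_number :: "'a set \<Rightarrow> ('a \<Rightarrow> 'a \<Rightarrow> bool) \<Rightarrow> nat" where
  "repetition_number V E = Max (range (\<lambda>d. card {v \<in> V. vertex_degree V E v = d}))"

text \<open>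
  Vertices are natural numbers, which covers every finite graph up to isomorphism.
\<close>

definition forces_repetition :: "nat \<Rightarrow> int \<Rightarrow> bool" where
  "forces_repetition k C \<longleftrightarrow>
     (\<forall>(V :: nat set) E. simple_graph V E \<longrightarrow>
        (\<exists>W\<subseteq>V. int (card W) \<ge> int (card V) - C \<and>
           int (repetition_number W (induced E W)) \<ge> min (int k) (int (card V) - C)))"

text \<open>
  \<open>forces_repetition k C\<close> fails for all negative \<open>C\<close> (consider the empty graph)
  and holds for some \<open>C\<close>, so the least such integer exists.
\<close>

definition repetition_C :: "nat \<Rightarrow> int" where
  "repetition_C k = (LEAST C. forces_repetition k C)"

end

theory Submission
  imports Defs "HOL-Library.Ramsey" "HOL-Number_Theory.Pocklington"
begin

text \<open>
  The least integer \<open>C(k)\<close> exists: a large graph contains, by the pigeonhole principle and Ramsey's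
  theorem, a clique or independent set \<open>A\<close> of \<open>k\<close> vertices with nearly equal degrees, and Dickson's
  lemma bounds the number of vertices outside \<open>A\<close> whose deletion makes these degrees equal.

  For the lower bound take \<open>M = \<lfloor>q/2\<rfloor>\<close> layers of \<open>N = r q\<^sup>4\<close> points \<open>(a, b) \<in> F\<^sub>q\<^sup>3 \<times> F\<^sub>q\<close>, \<open>q\<close> prime, and
  join points of layers \<open>l\<close> and \<open>l'\<close> if \<open>a \<bullet> a' + b + b' mod q < l + l'\<close>. Points with different
  \<open>a\<close> are pairwise independent, so in an arbitrary set \<open>W\<close> containing half of the vertices a second
  moment estimate shows that most degrees in layer \<open>l\<close> are close to \<open>l |W| / q\<close> plus a constant.
  Hence at most \<open>17 N\<close> vertices have the same degree in \<open>W\<close>, and \<open>C(k) > M N / 2\<close> if \<open>k > 17 N\<close>.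
  With \<open>N\<close> of order \<open>k\<close> and \<open>q\<close> at least of order \<open>ln k\<close> this is the claim.
\<close>

section \<open>Existence of \<open>C(k)\<close>\<close>

lemma incseq_nat_subseq:
  fixes g :: "nat \<Rightarrow> nat"
  shows "\<exists>r. strict_mono r \<and> incseq (g \<circ> r)"
proof -
  obtain r :: "nat \<Rightarrow> nat" where r: "strict_mono r" "monoseq (\<lambda>n. g (r n))"
    using seq_monosub[of g] by blast
  show ?thesis
  proof (cases "incseq (\<lambda>n. g (r n))")
    case True
    with r(1) show ?thesis by (auto simp: o_def)
  next
    case False
    with r(2) have dec: "decseq (\<lambda>n. g (r n))" by (simp add: monoseq_iff)
    \<comment> \<open>In the decreasing case the sequence is constant from the index of its minimum
      on.\<close>
    obtain N where N: "\<And>n. g (r N) \<le> g (r n)"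
      using ex_has_least_nat[of "\<lambda>_. True" 0 "\<lambda>n. g (r n)"] by blast
    have "g (r (N + n)) = g (r N)" for n
      using N[of "N + n"] decseqD[OF dec, of N "N + n"] by simp
    moreover have "strict_mono (\<lambda>n. r (N + n))"
      using r(1) by (auto simp: strict_mono_def)
    ultimately show ?thesis
      by (intro exI[of _ "\<lambda>n. r (N + n)"]) (auto simp: incseq_def)
  qed
qed

lemma pointwise_incseq_subseq:
  fixes f :: "nat \<Rightarrow> 'a \<Rightarrow> nat"
  assumes "finite T"
  shows "\<exists>r. strict_mono r \<and> (\<forall>t\<in>T. incseq (\<lambda>i. f (r i) t))"
  using assms
proof (induction T)
  case empty
  show ?case by (intro exI[of _ id]) (auto simp: strict_mono_def)
next
  case (insert t T)
  then obtain r where r: "strict_mono r" "\<forall>t\<in>T. incseq (\<lambda>i. f (r i) t)" by blast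
  obtain r' where r': "strict_mono r'" "incseq ((\<lambda>i. f (r i) t) \<circ> r')"
    using incseq_nat_subseq by blast
  \<comment> \<open>Thinning out for \<open>t\<close> preserves monotonicity in the coordinates
    treated before.\<close>
  have "incseq (\<lambda>i. f (r (r' i)) u)" if "u \<in> T" for u
    using r(2) r'(1) that unfolding incseq_def by (meson strict_mono_less_eq)
  with r r' show ?case
    by (intro exI[of _ "r \<circ> r'"]) (auto simp: strict_mono_def o_def)
qed

text \<open>A form of Dickson's lemma: the bound does not depend on \<open>n\<close>.\<close>

lemma bounded_minorant:
  fixes P :: "('a \<Rightarrow> nat) \<Rightarrow> bool"
  assumes "finite T"
  shows "\<exists>F. \<forall>n. P n \<longrightarrow> (\<exists>m. P m \<and> (\<forall>t\<in>T. m t \<le> n t) \<and> sum m T \<le> F)"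
proof (rule ccontr)
  assume "\<not> ?thesis"
  then have "\<forall>F. \<exists>n. P n \<and> (\<forall>m. P m \<longrightarrow> (\<forall>t\<in>T. m t \<le> n t) \<longrightarrow> \<not> sum m T \<le> F)"
    by blast
  then obtain f where f: "\<And>F. P (f F)"
      "\<And>F m. P m \<Longrightarrow> \<forall>t\<in>T. m t \<le> f F t \<Longrightarrow> \<not> sum m T \<le> F"
    by metis
  obtain r where r: "strict_mono r" "\<forall>t\<in>T. incseq (\<lambda>i. f (r i) t)"
    using pointwise_incseq_subseq[OF assms] by blast
  \<comment> \<open>\<open>f (r 0)\<close> lies below \<open>f (r j)\<close>, and its sum
    \<open>j\<close> is at most \<open>r j\<close>, so it is a minorant that the choice of
    \<open>f (r j)\<close> excludes.\<close>
  define j where "j = sum (f (r 0)) T"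
  have "\<forall>t\<in>T. f (r 0) t \<le> f (r j) t" using r(2) by (auto simp: incseq_def)
  with f have "\<not> j \<le> r j" unfolding j_def by blast
  then show False using strict_mono_imp_increasing[OF r(1)] by blast
qed

text \<open>The sum of the bounds for the single \<open>z\<close> serves all of them.\<close>

lemma bounded_minorant_family:
  fixes P :: "'z \<Rightarrow> ('a \<Rightarrow> nat) \<Rightarrow> bool"
  assumes "finite T" "finite Z"
  shows "\<exists>F. \<forall>z\<in>Z. \<forall>n. P z n \<longrightarrow> (\<exists>m. P z m \<and> (\<forall>t\<in>T. m t \<le> n t) \<and> sum m T \<le> F)"
proof -
  obtain F where F: "\<And>z n. P z n \<Longrightarrow> \<exists>m. P z m \<and> (\<forall>t\<in>T. m t \<le> n t) \<and> sum m T \<le> F z"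
    using bounded_minorant[OF assms(1), of "P _"] by metis
  have "F z \<le> sum F Z" if "z \<in> Z" for z using assms(2) that by (simp add: member_le_sum)
  with F show ?thesis by (meson le_trans)
qed

section \<open>Pigeonhole principle and Ramsey's theorem\<close>

lemma vertices_with_close_degrees:
  fixes d :: "'a \<Rightarrow> nat"
  assumes "finite V" "R > 0" "R * R < card V" "\<And>v. v \<in> V \<Longrightarrow> d v < card V"
  shows "\<exists>w. R \<le> card {v \<in> V. d v div R = w}"
proof (rule ccontr)
  assume "\<not> ?thesis"
  then have *: "card {v \<in> V. d v div R = w} \<le> R - 1" for w 
    using assms(2) by (metis Suc_pred' less_Suc_eq_le not_le)
  let ?n = "card V"
  have "d v div R \<le> ?n div R" if "v \<in> V" for v
    using assms(4)[OF that] by (intro div_le_mono) simp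
  then have "V \<subseteq> (\<Union>w\<in>{..?n div R}. {v \<in> V. d v div R = w})"
    by auto
  then have "?n \<le> (\<Sum>w\<in>{..?n div R}. card {v \<in> V. d v div R = w})"
    by (intro order_trans[OF card_mono card_UN_le]) (auto simp: assms(1))
  also have "\<dots> \<le> (\<Sum>w\<in>{..?n div R}. R - 1)" by (intro sum_mono *)
  also have "\<dots> = (?n div R + 1) * (R - 1)" by simp
  finally have 1: "?n \<le> (?n div R + 1) * (R - 1)" .
  \<comment> \<open>With b = \<open>?n div R\<close> the product in \<open>1\<close> is at most n +
    R - b - 1, which is below n because b is at least \<open>R\<close>.\<close>
  have "(?n div R + 1) * (R - 1) + (?n div R + 1) = (?n div R) * R + R"
    using assms(2) by (cases R) (auto simp: algebra_simps)
  moreover have "(?n div R) * R \<le> ?n" by simp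
  moreover have "R \<le> ?n div R"
    using assms(2,3) by (simp add: less_eq_div_iff_mult_less_eq)
  ultimately show False using 1 by linarith
qed

text \<open>Ramsey's theorem gives a clique or an independent set. Only the constant inner degree,
  \<open>k - 1\<close> or 0, matters later.\<close>

lemma homogeneous_subset:
  "\<exists>R>0. \<forall>(B :: 'a set) (E :: 'a \<Rightarrow> 'a \<Rightarrow> bool).
    symp E \<longrightarrow> irreflp E \<longrightarrow> finite B \<longrightarrow> R \<le> card B \<longrightarrow>
    (\<exists>A\<subseteq>B. card A = k \<and> (\<exists>c. \<forall>a\<in>A. card {u \<in> A. E a u} = c))"
proof -
  obtain R where R: "R \<ge> 1" "\<And>(B :: 'a set) F. finite B \<Longrightarrow> R \<le> card B \<Longrightarrow>
      \<exists>A\<subseteq>B. card A = k \<and> clique A F \<or> card A = k \<and> indep A F"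
    using ramsey2[of k k, where 'a = 'a] by blast
  show ?thesis
  proof (intro exI[of _ R] conjI allI impI)
    show "R > 0" using R(1) by simp
    fix B :: "'a set" and E :: "'a \<Rightarrow> 'a \<Rightarrow> bool"
    assume E: "symp E" "irreflp E" and B: "finite B" "R \<le> card B"
    define F where "F = {{u, v} |u v. E u v}"
    have F: "{u, v} \<in> F \<longleftrightarrow> E u v" for u v
      using E(1) unfolding F_def by (auto simp: doubleton_eq_iff dest: sympD)
    obtain A where A: "A \<subseteq> B" "card A = k" "clique A F \<or> indep A F" using R(2)[OF B, of F] by blast
    from A(3) show "\<exists>A\<subseteq>B. card A = k \<and> (\<exists>c. \<forall>a\<in>A. card {u \<in> A. E a u} = c)"
    proof
      assume "clique A F"
      then have "{u \<in> A. E a u} = A - {a}" if "a \<in> A" for a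
        using that irreflpD[OF E(2)] unfolding clique_def F by auto
      then have "\<forall>a\<in>A. card {u \<in> A. E a u} = k - 1" using A(2) by simp
      with A(1,2) show ?thesis by blast
    next
      assume "indep A F"
      then have "{u \<in> A. E a u} = {}" if "a \<in> A" for a
        using that E(2) unfolding indep_def F by (auto simp: irreflp_def) metis
      then have "\<forall>a\<in>A. card {u \<in> A. E a u} = 0" by (metis card.empty)
      with A(1,2) show ?thesis by blast
    qed
  qed
qed

section \<open>Repetition numbers and the equalising of degrees\<close>

lemma le_repetition_numberI:
  assumes "finite W" "A \<subseteq> W" "\<And>v. v \<in> A \<Longrightarrow> vertex_degree W E v = d"
  shows "card A \<le> repetition_number W E"
proof -
  \<comment> \<open>The range runs over all natural \<open>d\<close>, but its values are bounded by
    \<open>card W\<close>, so \<open>Max\<close> behaves as intended.\<close>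
  have "finite (range (\<lambda>d. card {v \<in> W. vertex_degree W E v = d}))"
    by (rule finite_subset[of _ "{..card W}"]) (auto intro!: card_mono assms(1))
  then have "card {v \<in> W. vertex_degree W E v = d} \<le> repetition_number W E"
    unfolding repetition_number_def by (intro Max_ge) auto
  moreover have "card A \<le> card {v \<in> W. vertex_degree W E v = d}"
    using assms by (intro card_mono) auto
  ultimately show ?thesis by simp
qed

lemma obtain_repetition:
  assumes "finite W"
  obtains d where "card {v \<in> W. vertex_degree W E v = d} = repetition_number W E"
proof -
  have "finite (range (\<lambda>d. card {v \<in> W. vertex_degree W E v = d}))"
    by (rule finite_subset[of _ "{..card W}"]) (auto intro!: card_mono assms(1))
  then have "repetition_number W E \<in> range (\<lambda>d. card {v \<in> W. vertex_degree W E v = d})"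
    unfolding repetition_number_def by (intro Max_in) auto
  with that show ?thesis by force
qed

lemma vertex_degree_induced:
  "v \<in> W \<Longrightarrow> vertex_degree W (induced E W) v = card {u \<in> W. E v u}"
  unfolding vertex_degree_def induced_def by (rule arg_cong[of _ _ card]) auto

text \<open>Turns a numerical minorant into an actual set of vertices to be deleted.\<close>

lemma subset_with_fibre_cards:
  assumes "finite U" "finite T" "\<And>t. t \<in> T \<Longrightarrow> m t \<le> card {u \<in> U. f u = t}"
  shows "\<exists>D\<subseteq>U. f ` D \<subseteq> T \<and> (\<forall>t\<in>T. card {u \<in> D. f u = t} = m t)"
proof -
  have "\<forall>t\<in>T. \<exists>D\<subseteq>{u \<in> U. f u = t}. card D = m t"
    using assms(3) by (metis obtain_subset_with_card_n)
  then obtain D where D: "\<And>t. t \<in> T \<Longrightarrow> D t \<subseteq> {u \<in> U. f u = t}" "\<And>t. t \<in> T \<Longrightarrow> card (D t) = m t"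
    by metis
  have "{u \<in> \<Union>(D ` T). f u = t} = D t" if "t \<in> T" for t using D(1) that by blast
  with D show ?thesis by (intro exI[of _ "\<Union>(D ` T)"]) auto
qed

lemma card_by_fibres:
  assumes "finite D" "finite T" "f ` D \<subseteq> T"
  shows "card {u \<in> D. Q (f u)} = (\<Sum>t | t \<in> T \<and> Q t. card {u \<in> D. f u = t})"
proof -
  have "{u \<in> D. Q (f u)} = (\<Union>t\<in>{t \<in> T. Q t}. {u \<in> D. f u = t})" using assms(3) by auto
  then show ?thesis using assms(1,2) by (simp add: card_UN_disjoint disjoint_iff)
qed

text \<open>
  The graph is modified only outside a homogeneous set \<open>A\<close> of \<open>k\<close> vertices with nearly equal
  degrees. Deleting all of \<open>V - A\<close> would equalise the degrees in \<open>A\<close>; which vertices are deleted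
  only matters through the numbers of deleted vertices with given neighbourhood in \<open>A\<close>, so
  Dickson's lemma shows that boundedly many deletions do as well.
\<close>

lemma ex_forces_repetition: "\<exists>C::nat. forces_repetition k (int C)"
proof -
  obtain R where R: "R > 0" "\<And>(B::nat set) (E :: nat \<Rightarrow> nat \<Rightarrow> bool). symp E \<Longrightarrow> irreflp E \<Longrightarrow> finite B \<Longrightarrow> R \<le> card B \<Longrightarrow>
    \<exists>A\<subseteq>B. card A = k \<and> (\<exists>c. \<forall>a\<in>A. card {u \<in> A. E a u} = c)"
    using homogeneous_subset[of k] by blast
  \<comment> \<open>\<open>T\<close> holds the possible neighbourhoods in \<open>A\<close>, with
    \<open>A\<close> enumerated by \<open>{..<k}\<close>. \<open>T\<close> and \<open>Z\<close>
    depend on \<open>k\<close> and \<open>R\<close> only, hence so does the bound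
    \<open>F\<close>.\<close>
  define T where "T = Pow {..<k}"
  define Z where "Z = ({..<k} \<rightarrow>\<^sub>E {..<R})"
  \<comment> \<open>\<open>P z m\<close>: deleting \<open>m S\<close> vertices of each type
    \<open>S\<close> lowers the i-th degree by \<open>z i\<close> plus a common, possibly negative,
    \<open>t\<close>. If \<open>z\<close> records the degrees modulo \<open>R\<close>, this makes
    them equal.\<close>
  define P where "P z m \<longleftrightarrow> (\<exists>t::int. \<forall>i<k. int (\<Sum>S | S \<in> T \<and> i \<in> S. m S) = int (z i) + t)"
    for z :: "nat \<Rightarrow> nat" and m :: "nat set \<Rightarrow> nat"
  have fin: "finite T" "finite Z" by (auto simp: T_def Z_def intro!: finite_PiE)
  then obtain F where F: "\<And>z n. z \<in> Z \<Longrightarrow> P z n \<Longrightarrow> \<exists>m. P z m \<and> (\<forall>t\<in>T. m t \<le> n t) \<and> sum m T \<le> F"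
    using bounded_minorant_family[of T Z P] by blast
  \<comment> \<open>\<open>R * R\<close> serves the pigeonhole step, and \<open>F\<close> bounds the
    number of deletions.\<close>
  define C where "C = R * R + F"
  have "forces_repetition k (int C)"
    unfolding forces_repetition_def
  proof (intro allI impI)
    fix V :: "nat set" and E
    assume "simple_graph V E"
    then have V: "finite V" and E: "symp E" "irreflp E" "\<And>u v. E u v \<Longrightarrow> u \<in> V \<and> v \<in> V"
      by (auto simp: simple_graph_def)
    show "\<exists>W\<subseteq>V. int (card W) \<ge> int (card V) - int C \<and>
           int (repetition_number W (induced E W)) \<ge> min (int k) (int (card V) - int C)"
    proof (cases "card V \<le> C")
      case True
      then show ?thesis by (intro exI[of _ "{}"]) auto
    next
      case False
      define d where "d v = card {u \<in> V. E v u}" for v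
      have "d v < card V" if "v \<in> V" for v
        unfolding d_def using that V E(2) by (intro psubset_card_mono) (auto dest: irreflpD)
      then obtain w where w: "R \<le> card {v \<in> V. d v div R = w}"
        using vertices_with_close_degrees[OF V R(1), of d] False C_def by auto
      obtain A c where A: "A \<subseteq> {v \<in> V. d v div R = w}" "card A = k"
          "\<And>a. a \<in> A \<Longrightarrow> card {u \<in> A. E a u} = c"
        using R(2)[OF E(1,2) _ w] V by auto
      have "finite A" using A(1) V by (auto intro: finite_subset[of A V])
      then obtain e where e: "bij_betw e {..<k} A"
        using A(2) ex_bij_betw_nat_finite[of A] by (auto simp: atLeast0LessThan)
      have eA: "e i \<in> A" if "i < k" for i using e that by (auto simp: bij_betw_def)
      define \<tau> where "\<tau> u = {i. i < k \<and> E (e i) u}" for u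
      have \<tau>: "\<tau> ` X \<subseteq> T" for X by (auto simp: \<tau>_def T_def)
      define n where "n S = card {u \<in> V - A. \<tau> u = S}" for S
      define z where "z = restrict (\<lambda>i. d (e i) mod R) {..<k}"
      have zZ: "z \<in> Z" using R(1) by (auto simp: z_def Z_def)
      have nb: "card {u \<in> X. E (e i) u} = (\<Sum>S | S \<in> T \<and> i \<in> S. card {u \<in> X. \<tau> u = S})"
        if "i < k" "finite X" for i X
        using card_by_fibres[OF that(2) fin(1) \<tau>, of "\<lambda>S. i \<in> S"] that(1) by (simp add: \<tau>_def)
      have d: "d (e i) = w * R + z i" if "i < k" for i
        using A(1) eA[OF that] that by (auto simp: z_def)
      \<comment> \<open>Deleting all of \<open>V - A\<close> would leave every vertex of
        \<open>A\<close> with degree \<open>c\<close>, so \<open>n\<close> satisfies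
        \<open>P z\<close> with \<open>t = w * R - c\<close>.\<close>
      have split: "d (e i) = c + (\<Sum>S | S \<in> T \<and> i \<in> S. n S)" if "i < k" for i
      proof -
        have "{u \<in> V. E (e i) u} = {u \<in> A. E (e i) u} \<union> {u \<in> V - A. E (e i) u}" using A(1) by auto
        then have "d (e i) = card {u \<in> A. E (e i) u} + card {u \<in> V - A. E (e i) u}"
          unfolding d_def using V \<open>finite A\<close> by (simp add: card_Un_disjoint disjoint_iff)
        then show ?thesis using A(3) eA[OF that] nb[OF that, of "V - A"] V by (simp add: n_def)
      qed
      have "int (\<Sum>S | S \<in> T \<and> i \<in> S. n S) = int (z i) + (int (w * R) - int c)" if "i < k" for i
      proof -
        have "int (w * R + z i) = int (c + (\<Sum>S | S \<in> T \<and> i \<in> S. n S))"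
          using d[OF that] split[OF that] by simp
        then show ?thesis unfolding of_nat_add by linarith
      qed
      then have "P z n" unfolding P_def by blast
      then obtain m where m: "P z m" "\<And>t. t \<in> T \<Longrightarrow> m t \<le> n t" "sum m T \<le> F"
        using F[OF zZ] by blast
      obtain D where D: "D \<subseteq> V - A" "\<And>t. t \<in> T \<Longrightarrow> card {u \<in> D. \<tau> u = t} = m t"
        using subset_with_fibre_cards[of "V - A" T m \<tau>] m(2) fin V by (auto simp: n_def)
      have "finite D" using D(1) V finite_subset by blast
      have "card D = sum m T"
        using card_by_fibres[OF \<open>finite D\<close> fin(1) \<tau>, of "\<lambda>_. True"] D(2) by simp
      then have cD: "card D \<le> F" using m(3) by simp
      obtain t where t: "\<And>i. i < k \<Longrightarrow> int (\<Sum>S | S \<in> T \<and> i \<in> S. m S) = int (z i) + t"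
        using m(1) unfolding P_def by blast
      have deg: "vertex_degree (V - D) (induced E (V - D)) a = nat (int (w * R) - t)" if aA: "a \<in> A" for a
      proof -
        obtain i where i: "i < k" "a = e i" using aA unfolding bij_betw_imp_surj_on[OF e, symmetric] by auto
        have "{u \<in> V. E a u} = {u \<in> V - D. E a u} \<union> {u \<in> D. E a u}" using D(1) by auto
        then have "d a = card {u \<in> V - D. E a u} + card {u \<in> D. E a u}"
          unfolding d_def using V \<open>finite D\<close> by (simp add: card_Un_disjoint disjoint_iff)
        moreover have "int (card {u \<in> D. E a u}) = int (z i) + t"
          using nb[OF i(1) \<open>finite D\<close>] D(2) t[OF i(1)] i(2) by simp
        moreover have "int (d a) = int (w * R) + int (z i)" using d[OF i(1)] i(2) by simp
        ultimately have "int (card {u \<in> V - D. E a u}) = int (w * R) - t" by linarith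
        then have "card {u \<in> V - D. E a u} = nat (int (w * R) - t)" by linarith
        moreover have "a \<in> V - D" using aA D(1) A(1) by auto
        ultimately show ?thesis by (simp only: vertex_degree_induced)
      qed
      have "k \<le> repetition_number (V - D) (induced E (V - D))"
        using le_repetition_numberI[OF _ _ deg, of A] V A(1,2) D(1) by auto
      moreover have "int (card (V - D)) \<ge> int (card V) - int C"
      proof -
        have "card (V - D) = card V - card D"
          using D(1) \<open>finite D\<close> by (intro card_Diff_subset) auto
        moreover have "F \<le> C" unfolding C_def by simp
        ultimately show ?thesis using cD by linarith
      qed
      ultimately show ?thesis by (intro exI[of _ "V - D"]) auto
    qed
  qed
  then show ?thesis by blast
qed

text \<open>A least integer need not exist in general; here the empty graph excludes negative
  values, so the least natural number with the property is also the least integer.\<close>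

lemma forces_repetition_C: "forces_repetition k (repetition_C k)"
proof -
  define c where "c = (LEAST C::nat. forces_repetition k (int C))"
  have c: "forces_repetition k (int c)"
    unfolding c_def using ex_forces_repetition by (rule LeastI_ex)
  have pos: "0 \<le> C" if "forces_repetition k C" for C
  proof -
    have "simple_graph {} (\<lambda>_ _. False)" by (auto simp: simple_graph_def symp_def irreflp_def)
    with that show ?thesis unfolding forces_repetition_def by fastforce
  qed
  have "int c \<le> C" if "forces_repetition k C" for C
    using that pos[OF that] Least_le[of "\<lambda>C. forces_repetition k (int C)" "nat C"]
    unfolding c_def by simp
  with c have "repetition_C k = int c"
    unfolding repetition_C_def by (intro Least_equality)
  with c show ?thesis by simp
qed

section \<open>The lower bound\<close>

lemma sum_affine_mod:
  fixes q c e :: int and \<phi> :: "int \<Rightarrow> 'a::comm_monoid_add"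
  assumes "q > 0" "coprime c q"
  shows "(\<Sum>x\<in>{0..<q}. \<phi> ((c * x + e) mod q)) = sum \<phi> {0..<q}"
proof -
  have inj: "inj_on (\<lambda>x. (c * x + e) mod q) {0..<q}"
  proof (rule inj_onI)
    fix x y assume xy: "x \<in> {0..<q}" "y \<in> {0..<q}" and "(c * x + e) mod q = (c * y + e) mod q"
    then have "[c * x + e = c * y + e] (mod q)" by (simp add: cong_def)
    then have "[x = y] (mod q)"
      using assms(2) by (simp add: cong_add_rcancel cong_mult_lcancel)
    with xy show "x = y" by (simp add: cong_def)
  qed
  moreover have "(\<lambda>x. (c * x + e) mod q) ` {0..<q} = {0..<q}"
    using assms(1) by (intro endo_inj_surj inj) auto
  ultimately show ?thesis
    by (intro sum.reindex_cong[symmetric]) auto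
qed

text \<open>Some coefficient is invertible modulo \<open>q\<close>. Summing over its coordinate
  first permutes the residues and gives 0.\<close>

lemma sum_linear_form_eq_0:
  fixes q :: int and \<phi> :: "int \<Rightarrow> real"
  assumes "prime q" "sum \<phi> {0..<q} = 0" "\<not> (q dvd c1 \<and> q dvd c2 \<and> q dvd c3)"
  shows "(\<Sum>(x1, x2, x3) \<in> {0..<q} \<times> {0..<q} \<times> {0..<q}. \<phi> ((c1 * x1 + c2 * x2 + c3 * x3 + e) mod q)) = 0"
proof -
  let ?Q = "{0..<q}"
  have q: "q > 0" using assms(1) by (simp add: prime_gt_0_int)
  have line: "(\<Sum>x\<in>?Q. \<phi> ((c * x + e) mod q)) = 0" if "\<not> q dvd c" for c e
    using sum_affine_mod[OF q, of c \<phi> e] prime_imp_coprime[OF assms(1) that] assms(2)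
    by (simp add: coprime_commute)
  have eq: "(\<Sum>(x1, x2, x3) \<in> ?Q \<times> ?Q \<times> ?Q. \<phi> ((c1 * x1 + c2 * x2 + c3 * x3 + e) mod q))
      = (\<Sum>x1\<in>?Q. \<Sum>x2\<in>?Q. \<Sum>x3\<in>?Q. \<phi> ((c1 * x1 + c2 * x2 + c3 * x3 + e) mod q))"
    by (simp add: sum.cartesian_product)
  from assms(3) consider "\<not> q dvd c1" | "\<not> q dvd c2" | "\<not> q dvd c3" by blast
  then show ?thesis
  proof cases
    case 1
    have "(\<Sum>x1\<in>?Q. \<Sum>x2\<in>?Q. \<Sum>x3\<in>?Q. \<phi> ((c1 * x1 + c2 * x2 + c3 * x3 + e) mod q))
        = (\<Sum>x2\<in>?Q. \<Sum>x1\<in>?Q. \<Sum>x3\<in>?Q. \<phi> ((c1 * x1 + c2 * x2 + c3 * x3 + e) mod q))"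
      by (rule sum.swap)
    also have "\<dots> = (\<Sum>x2\<in>?Q. \<Sum>x3\<in>?Q. \<Sum>x1\<in>?Q. \<phi> ((c1 * x1 + (c2 * x2 + c3 * x3 + e)) mod q))"
      by (simp only: add.assoc) (intro sum.cong refl sum.swap)
    also have "\<dots> = 0" by (simp only: line[OF 1] sum.neutral_const)
    finally show ?thesis by (simp only: eq)
  next
    case 2
    have "(\<Sum>x1\<in>?Q. \<Sum>x2\<in>?Q. \<Sum>x3\<in>?Q. \<phi> ((c1 * x1 + c2 * x2 + c3 * x3 + e) mod q))
        = (\<Sum>x1\<in>?Q. \<Sum>x3\<in>?Q. \<Sum>x2\<in>?Q. \<phi> ((c1 * x1 + c2 * x2 + c3 * x3 + e) mod q))"
      by (intro sum.cong refl sum.swap)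
    also have "\<dots> = (\<Sum>x1\<in>?Q. \<Sum>x3\<in>?Q. \<Sum>x2\<in>?Q. \<phi> ((c2 * x2 + (c1 * x1 + c3 * x3 + e)) mod q))"
      by (simp only: ac_simps)
    also have "\<dots> = 0" by (simp only: line[OF 2] sum.neutral_const)
    finally show ?thesis by (simp only: eq)
  next
    case 3
    have "(\<Sum>x1\<in>?Q. \<Sum>x2\<in>?Q. \<Sum>x3\<in>?Q. \<phi> ((c1 * x1 + c2 * x2 + c3 * x3 + e) mod q))
        = (\<Sum>x1\<in>?Q. \<Sum>x2\<in>?Q. \<Sum>x3\<in>?Q. \<phi> ((c3 * x3 + (c1 * x1 + c2 * x2 + e)) mod q))"
      by (simp only: ac_simps)
    also have "\<dots> = 0" by (simp only: line[OF 3] sum.neutral_const)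
    finally show ?thesis by (simp only: eq)
  qed
qed

text \<open>Modulo an odd prime factor \<open>q\<close> of the Fermat number,
  \<open>2 ^ (2 ^ s)\<close> is -1 and not 1, so 2 has order exactly \<open>2 ^ (s + 1)\<close>,
  which divides \<open>q - 1\<close>.\<close>

lemma fermat_number_prime_factor:
  "\<exists>q::nat. prime q \<and> 2 ^ (s + 1) < q \<and> q \<le> 2 ^ (2 ^ s) + 1"
proof -
  let ?f = "2 ^ (2 ^ s) + 1 :: nat"
  obtain q where q: "prime q" "q dvd ?f" using prime_factor_nat[of ?f] by auto
  have "odd ?f" by simp
  then have "q \<noteq> 2" using q(2) by blast
  then have q2: "q > 2" using prime_ge_2_nat[OF q(1)] by simp
  then have cop: "coprime q 2" using q(1) primes_coprime two_is_prime_nat by blast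
  have m1: "[2 ^ (2 ^ s) = - 1] (mod int q)"
  proof -
    have "int q dvd 2 ^ (2 ^ s) + 1" using q(2) by (metis of_nat_dvd_iff of_nat_Suc of_nat_numeral of_nat_power Suc_eq_plus1 add.commute)
    then show ?thesis by (simp add: cong_iff_dvd_diff)
  qed
  have "\<not> ord q 2 dvd 2 ^ s"
  proof
    assume "ord q 2 dvd 2 ^ s"
    then have "[2 ^ (2 ^ s) = 1] (mod q)" by (simp only: ord_divides)
    then have "[2 ^ (2 ^ s) = 1] (mod int q)" by (metis cong_int_iff of_nat_1 of_nat_numeral of_nat_power)
    with m1 have "[- 1 = 1] (mod int q)" using cong_sym cong_trans by blast
    then have "int q dvd 2" by (simp add: cong_iff_dvd_diff)
    then show False using q2 zdvd_imp_le by fastforce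
  qed
  moreover have "ord q 2 dvd 2 ^ (s + 1)"
  proof -
    have "[(2 ^ (2 ^ s))\<^sup>2 = (- 1)\<^sup>2] (mod int q)" by (rule cong_pow[OF m1])
    then have "[2 ^ (2 ^ (s + 1)) = 1] (mod int q)" by (simp add: power_mult[symmetric] mult.commute)
    then have "[2 ^ (2 ^ (s + 1)) = 1] (mod q)" by (metis cong_int_iff of_nat_1 of_nat_numeral of_nat_power)
    then show ?thesis by (simp only: ord_divides)
  qed
  ultimately have "ord q 2 = 2 ^ (s + 1)"
    by (metis Suc_eq_plus1 divides_primepow_nat le_Suc_eq le_imp_power_dvd two_is_prime_nat)
  then have "2 ^ (s + 1) dvd q - 1"
    using order_divides_totient[OF cop] q(1) by (simp add: totient_prime)
  then have "2 ^ (s + 1) \<le> q - 1" using q2 by (intro dvd_imp_le) auto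
  with q2 q dvd_imp_le[OF q(2)] show ?thesis by (intro exI[of _ q]) auto
qed

section \<open>Transfer to arbitrary vertex types\<close>

text \<open>An injection into the naturals carries the graph to the type required by
  \<open>forces_repetition\<close>. The repetition number becomes an explicit set \<open>A\<close>
  of vertices of equal degree.\<close>

lemma forces_repetition_transfer:
  fixes V :: "'a set"
  assumes "forces_repetition k C" "simple_graph V E"
  obtains W A d where "W \<subseteq> V" "A \<subseteq> W" "int (card W) \<ge> int (card V) - C"
    "int (card A) \<ge> min (int k) (int (card V) - C)" "\<And>v. v \<in> A \<Longrightarrow> card {u \<in> W. E v u} = d"
proof -
  have V: "finite V" and E: "symp E" "irreflp E" "\<And>u v. E u v \<Longrightarrow> u \<in> V \<and> v \<in> V"
    using assms(2) by (auto simp: simple_graph_def)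
  obtain g :: "'a \<Rightarrow> nat" where g: "inj_on g V" using finite_imp_inj_to_nat_seg[OF V] by blast
  define E' where "E' m n \<longleftrightarrow> (\<exists>u v. m = g u \<and> n = g v \<and> E u v)" for m n
  have E': "E' (g u) (g v) \<longleftrightarrow> E u v" if "u \<in> V" "v \<in> V" for u v
    unfolding E'_def using that g E(3) by (metis inj_on_contraD)
  have "simple_graph (g ` V) E'"
    unfolding simple_graph_def
  proof (intro conjI allI impI)
    show "symp E'" using E(1) unfolding E'_def symp_def by blast
    show "irreflp E'" using E(2,3) g unfolding E'_def irreflp_def inj_on_def by metis
  qed (use V E(3) in \<open>auto simp: E'_def\<close>)
  with assms(1) obtain W' where W': "W' \<subseteq> g ` V" "int (card W') \<ge> int (card (g ` V)) - C"
      "int (repetition_number W' (induced E' W')) \<ge> min (int k) (int (card (g ` V)) - C)"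
    unfolding forces_repetition_def by blast
  then obtain W where W: "W \<subseteq> V" "W' = g ` W" by (meson subset_imageE)
  have gW: "inj_on g W" using g W(1) inj_on_subset by blast
  have fW: "finite W" using V W(1) finite_subset by blast
  obtain d where d: "card {v \<in> W'. vertex_degree W' (induced E' W') v = d} = repetition_number W' (induced E' W')"
    using obtain_repetition[of W' "induced E' W'"] fW W(2) by blast
  define A where "A = {v \<in> W. card {u \<in> W. E v u} = d}"
  have deg: "vertex_degree W' (induced E' W') (g v) = card {u \<in> W. E v u}" if "v \<in> W" for v
  proof -
    have "{u \<in> W'. E' (g v) u} = g ` {u \<in> W. E v u}"
      using W that E' by (auto simp: subset_iff)
    moreover have "inj_on g {u \<in> W. E v u}" using gW by (rule inj_on_subset) auto
    ultimately have "card {u \<in> W'. E' (g v) u} = card {u \<in> W. E v u}" by (simp add: card_image)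
    with that W(2) show ?thesis by (simp add: vertex_degree_induced)
  qed
  have "{v \<in> W'. vertex_degree W' (induced E' W') v = d} = g ` A"
    using deg W(2) by (auto simp: A_def)
  moreover have "inj_on g A" using gW by (rule inj_on_subset) (auto simp: A_def)
  ultimately have "card A = repetition_number W' (induced E' W')" using d by (simp add: card_image)
  moreover have "card W' = card W" "card (g ` V) = card V" using gW g W(2) by (simp_all add: card_image)
  ultimately show ?thesis
    using W'(2,3) by (intro that[OF W(1), of A d]) (auto simp only: A_def mem_Collect_eq subset_iff)
qed

text \<open>
  A vertex \<open>(l, i, a, b)\<close> is the \<open>i\<close>-th copy of the point \<open>(a, b)\<close> of \<open>F\<^sub>q\<^sup>3 \<times> F\<^sub>q\<close> in layer \<open>l\<close>. The copies
  only serve to tune the layer size to a given \<open>k\<close>.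
\<close>

type_synonym vertex = "nat \<times> nat \<times> (int \<times> int \<times> int) \<times> int"

fun level :: "vertex \<Rightarrow> nat" where "level (l, i, a, b) = l"

fun slope :: "vertex \<Rightarrow> int \<times> int \<times> int" where "slope (l, i, a, b) = a"

fun bilin :: "vertex \<Rightarrow> vertex \<Rightarrow> int" where
  "bilin (_, _, (a1, a2, a3), b) (_, _, (a1', a2', a3'), b') = a1 * a1' + a2 * a2' + a3 * a3' + b + b'"

lemma bilin_commute: "bilin x y = bilin y x"
  by (cases x rule: level.cases; cases y rule: level.cases) auto

section \<open>The layered graph\<close>

text \<open>By \<open>levels\<close> every threshold \<open>l + l'\<close> is at most
  \<open>q\<close>, so it admits exactly the fraction \<open>(l + l') / q\<close> of the
  residues.\<close>

locale layered_graph =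
  fixes q r M :: nat
  assumes prime_q: "prime q" and r_pos: "r > 0" and M_pos: "M > 0" and levels: "2 * M \<le> q"
begin

definition "Q = {0..<int q}"

definition layer :: "nat \<Rightarrow> vertex set" where
  "layer l = {l} \<times> {..<r} \<times> (Q \<times> Q \<times> Q) \<times> Q"

definition V :: "vertex set" where
  "V = {..<M} \<times> {..<r} \<times> (Q \<times> Q \<times> Q) \<times> Q"

definition E :: "vertex \<Rightarrow> vertex \<Rightarrow> bool" where
  "E x y \<longleftrightarrow> x \<in> V \<and> y \<in> V \<and> x \<noteq> y \<and> bilin x y mod int q < int (level x + level y)"

lemma q_pos: "q > 0" using prime_q prime_gt_0_nat by blast

lemma finite_Q: "finite Q" and card_Q: "card Q = q"
  by (auto simp: Q_def)

lemma finite_V: "finite V" and card_V: "card V = M * (r * q ^ 4)"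
  by (auto simp: V_def finite_Q card_cartesian_product card_Q power4_eq_xxxx)

lemma finite_layer: "finite (layer l)" and card_layer: "card (layer l) = r * q ^ 4"
  by (auto simp: layer_def finite_Q card_cartesian_product card_Q power4_eq_xxxx)

lemma V_eq_layers: "V = (\<Union>l<M. layer l)"
  by (auto simp: V_def layer_def)

lemma sum_layer: "sum f (layer l) = (\<Sum>i<r. \<Sum>a\<in>Q \<times> Q \<times> Q. \<Sum>b\<in>Q. f (l, i, a, b))"
proof -
  have "layer l = Pair l ` ({..<r} \<times> (Q \<times> Q \<times> Q) \<times> Q)" by (auto simp: layer_def)
  then show ?thesis by (simp add: sum.reindex inj_on_def sum.cartesian_product split_def)
qed

lemma level_layer: "x \<in> layer l \<Longrightarrow> level x = l"
  by (auto simp: layer_def)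

lemma level_less: "x \<in> V \<Longrightarrow> level x < M"
  by (auto simp: V_def)

lemma simple_graph_E: "simple_graph V E"
  unfolding simple_graph_def symp_def irreflp_def
  by (auto simp: E_def finite_V bilin_commute add.commute)

lemma card_slope_class:
  "card {y' \<in> V. slope y' = slope y} \<le> M * (r * q)"
proof -
  have "{y' \<in> V. slope y' = slope y} \<subseteq> {..<M} \<times> {..<r} \<times> {slope y} \<times> Q"
    by (auto simp: V_def)
  then have "card {y' \<in> V. slope y' = slope y} \<le> card ({..<M} \<times> {..<r} \<times> {slope y} \<times> Q)"
    by (intro card_mono) (auto simp: finite_Q)
  then show ?thesis by (simp add: card_cartesian_product card_Q)
qed

text \<open>Coordinates are reduced representatives, so congruent ones are equal. This yields the
  nonzero linear form needed for \<open>sum_linear_form_eq_0\<close>.\<close>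

lemma slopes_differ:
  assumes "y \<in> V" "y' \<in> V" "slope y = (a1, a2, a3)" "slope y' = (c1, c2, c3)" "slope y \<noteq> slope y'"
  shows "\<not> (int q dvd c1 - a1 \<and> int q dvd c2 - a2 \<and> int q dvd c3 - a3)"
proof -
  have "c = a" if "int q dvd c - a" "a \<in> Q" "c \<in> Q" for a c
    using that by (auto simp: Q_def mod_eq_dvd_iff[symmetric])
  moreover have "a1 \<in> Q" "a2 \<in> Q" "a3 \<in> Q" "c1 \<in> Q" "c2 \<in> Q" "c3 \<in> Q"
    using assms(1-4) by (auto simp: V_def)
  ultimately show ?thesis using assms(3-5) by auto
qed

text \<open>
  Vertices of different slopes are independent: shifting \<open>b\<close> makes the first factor depend on \<open>b\<close>
  only, and the second one then averages to zero over \<open>a\<close>.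
\<close>

lemma sum_layer_eq_0:
  fixes \<phi> \<psi> :: "int \<Rightarrow> real"
  assumes "y \<in> V" "y' \<in> V" "slope y \<noteq> slope y'" "sum \<psi> Q = 0"
  shows "(\<Sum>x\<in>layer l. \<phi> (bilin x y mod int q) * \<psi> (bilin x y' mod int q)) = 0"
proof -
  obtain m j a1 a2 a3 b where y: "y = (m, j, (a1, a2, a3), b)" by (cases y rule: level.cases) auto
  obtain m' j' c1 c2 c3 d where y': "y' = (m', j', (c1, c2, c3), d)" by (cases y' rule: level.cases) auto
  let ?q = "int q"
  \<comment> \<open>\<open>?s\<close> is the difference of the two linear forms: with
    \<open>t = bilin x y\<close>, the value \<open>bilin x y'\<close> is
    \<open>?s + t + d - b\<close>.\<close>
  let ?s = "\<lambda>(x1, x2, x3). (c1 - a1) * x1 + (c2 - a2) * x2 + (c3 - a3) * x3"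
  let ?h = "\<lambda>i x u. \<phi> (bilin (l, i, x, u) y mod ?q) * \<psi> (bilin (l, i, x, u) y' mod ?q)"
  have mod_shift: "(s + (t mod ?q + d - b)) mod ?q = (s + (t + d - b)) mod ?q" for s t
    using mod_add_left_eq[of t ?q "s + d - b"] by (simp add: algebra_simps)
  have shift: "(\<Sum>u\<in>Q. ?h i x u) = (\<Sum>u\<in>Q. \<phi> u * \<psi> ((?s x + (u + d - b)) mod ?q))" for i x
  proof -
    obtain x1 x2 x3 where x: "x = (x1, x2, x3)" by (cases x) auto
    let ?F = "\<lambda>t. \<phi> t * \<psi> ((?s x + (t + d - b)) mod ?q)"
    let ?e = "x1 * a1 + x2 * a2 + x3 * a3 + b"
    have "(\<Sum>u\<in>Q. ?F ((1 * u + ?e) mod ?q)) = sum ?F Q"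
      unfolding Q_def using q_pos by (intro sum_affine_mod) auto
    moreover have "?F ((1 * u + ?e) mod ?q) = ?h i x u" for u
    proof -
      have "(?s x + ((1 * u + ?e) mod ?q + d - b)) mod ?q = (?s x + ((1 * u + ?e) + d - b)) mod ?q"
        by (rule mod_shift)
      also have "?s x + ((1 * u + ?e) + d - b) = bilin (l, i, x, u) y'"
        by (simp add: x y' algebra_simps)
      finally show ?thesis by (simp add: x y ac_simps)
    qed
    ultimately show ?thesis by simp
  qed
  have "(\<Sum>x\<in>layer l. \<phi> (bilin x y mod ?q) * \<psi> (bilin x y' mod ?q))
      = (\<Sum>i<r. \<Sum>x\<in>Q \<times> Q \<times> Q. \<Sum>u\<in>Q. ?h i x u)"
    by (simp only: sum_layer)
  also have "\<dots> = (\<Sum>i<r. \<Sum>x\<in>Q \<times> Q \<times> Q. \<Sum>u\<in>Q. \<phi> u * \<psi> ((?s x + (u + d - b)) mod ?q))"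
    by (simp only: shift)
  also have "\<dots> = (\<Sum>i<r. \<Sum>u\<in>Q. \<Sum>x\<in>Q \<times> Q \<times> Q. \<phi> u * \<psi> ((?s x + (u + d - b)) mod ?q))"
    by (intro sum.cong refl sum.swap)
  also have "\<dots> = (\<Sum>i<r. \<Sum>u\<in>Q. \<phi> u * (\<Sum>x\<in>Q \<times> Q \<times> Q. \<psi> ((?s x + (u + d - b)) mod ?q)))"
    by (simp only: sum_distrib_left)
  also have "\<dots> = 0"
  proof -
    have "(\<Sum>x\<in>Q \<times> Q \<times> Q. \<psi> ((?s x + e) mod ?q)) = 0" for e
      using sum_linear_form_eq_0[of ?q \<psi> "c1 - a1" "c2 - a2" "c3 - a3" e] prime_q assms(4)
        slopes_differ[OF assms(1,2) _ _ assms(3)]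
      unfolding Q_def by (simp add: y y' split_def)
    then show ?thesis by simp
  qed
  finally show ?thesis .
qed

section \<open>Second moment of the degrees\<close>

text \<open>Each summand is an edge indicator minus its mean over \<open>x\<close> in layer
  \<open>l\<close>, for \<open>l < M\<close> and \<open>W\<close> inside \<open>V\<close>. The term
  for \<open>y = x\<close> is kept, so that the summands have mean zero.\<close>

definition dev :: "vertex set \<Rightarrow> nat \<Rightarrow> vertex \<Rightarrow> real" where
  "dev W l x = (\<Sum>y\<in>W. of_bool (bilin x y mod int q < int (l + level y)) - real (l + level y) / real q)"

lemma sum_centred_threshold:
  assumes "t \<le> q"
  shows "(\<Sum>u\<in>Q. of_bool (u < int t) - real t / real q) = 0"
proof -
  have "Q \<inter> {u. u < int t} = {0..<int t}" using assms by (auto simp: Q_def)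
  then have "(\<Sum>u\<in>Q. of_bool (u < int t) :: real) = real t"
    using finite_Q by (simp add: sum_of_bool_eq)
  then show ?thesis using q_pos by (simp add: sum_subtractf card_Q)
qed

text \<open>Expand the square. Pairs of different slopes contribute 0; each other pair contributes
  at most the layer size, and every \<open>y\<close> has at most \<open>M * (r * q)\<close> partners
  of its slope.\<close>

lemma sum_dev_squared_le:
  assumes "W \<subseteq> V" "l < M"
  shows "(\<Sum>x\<in>layer l. (dev W l x)\<^sup>2) \<le> real (card W) * real (M * (r * q)) * real (r * q ^ 4)"
proof -
  define g where "g y u = of_bool (u < int (l + level y)) - real (l + level y) / real q"
    for y :: vertex and u
  have le_q: "l + level y \<le> q" if "y \<in> W" for y
    using level_less[of y] that assms levels by auto
  have g_mean: "sum (g y) Q = 0" if "y \<in> W" for y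
    unfolding g_def using sum_centred_threshold[OF le_q[OF that]] by simp
  have g_bound: "\<bar>g y u\<bar> \<le> 1" if "y \<in> W" for y u
    using le_q[OF that] q_pos by (auto simp: g_def abs_le_iff divide_simps)
  have finW: "finite W" using assms(1) finite_V finite_subset by blast
  let ?h = "\<lambda>x y. g y (bilin x y mod int q)"
  have cov: "(\<Sum>x\<in>layer l. ?h x y * ?h x y') \<le> of_bool (slope y' = slope y) * real (r * q ^ 4)"
    if "y \<in> W" "y' \<in> W" for y y'
  proof (cases "slope y' = slope y")
    case True
    have "(\<Sum>x\<in>layer l. ?h x y * ?h x y') \<le> (\<Sum>x\<in>layer l. 1)"
    proof (intro sum_mono)
      fix x
      have "\<bar>?h x y * ?h x y'\<bar> \<le> 1 * 1"
        unfolding abs_mult using g_bound that by (intro mult_mono) auto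
      then show "?h x y * ?h x y' \<le> 1" by linarith
    qed
    then show ?thesis using True by (simp add: card_layer)
  next
    case False
    then show ?thesis
      using sum_layer_eq_0[where y = y and y' = y' and \<phi> = "g y" and \<psi> = "g y'" and l = l,
          OF _ _ _ g_mean[OF that(2)]] subsetD[OF assms(1) that(1)] subsetD[OF assms(1) that(2)]
      by auto
  qed
  have "(\<Sum>x\<in>layer l. (dev W l x)\<^sup>2) = (\<Sum>x\<in>layer l. \<Sum>y\<in>W. \<Sum>y'\<in>W. ?h x y * ?h x y')"
    unfolding dev_def g_def power2_eq_square by (simp only: sum_product)
  also have "\<dots> = (\<Sum>y\<in>W. \<Sum>x\<in>layer l. \<Sum>y'\<in>W. ?h x y * ?h x y')" by (rule sum.swap)
  also have "\<dots> = (\<Sum>y\<in>W. \<Sum>y'\<in>W. \<Sum>x\<in>layer l. ?h x y * ?h x y')"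
    by (intro sum.cong refl sum.swap)
  also have "\<dots> \<le> (\<Sum>y\<in>W. \<Sum>y'\<in>W. of_bool (slope y' = slope y) * real (r * q ^ 4))"
    by (intro sum_mono cov)
  also have "\<dots> = (\<Sum>y\<in>W. real (card {y' \<in> W. slope y' = slope y}) * real (r * q ^ 4))"
    using finW by (simp add: sum_distrib_right[symmetric] sum_of_bool_eq Collect_conj_eq Int_commute)
  also have "\<dots> \<le> (\<Sum>y\<in>W. real (M * (r * q)) * real (r * q ^ 4))"
  proof (intro sum_mono mult_right_mono)
    fix y
    have "card {y' \<in> W. slope y' = slope y} \<le> card {y' \<in> V. slope y' = slope y}"
      using assms(1) finite_V by (intro card_mono) auto
    then show "real (card {y' \<in> W. slope y' = slope y}) \<le> real (M * (r * q))"
      using card_slope_class[of y] by (meson of_nat_mono order_trans)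
  qed simp
  finally show ?thesis by (simp add: mult.assoc)
qed

text \<open>The error 1 accounts for \<open>x\<close> itself, which \<open>dev\<close> may count
  although the graph has no loops.\<close>

lemma degree_eq:
  assumes "W \<subseteq> V" "x \<in> W"
  shows "\<bar>real (card {u \<in> W. E x u}) - (real (level x) * real (card W) / real q
    + (\<Sum>y\<in>W. real (level y)) / real q) - dev W (level x) x\<bar> \<le> 1"
proof -
  have finW: "finite W" using assms(1) finite_V finite_subset by blast
  let ?B = "{u \<in> W. bilin x u mod int q < int (level x + level u)}"
  have dev: "dev W (level x) x = real (card ?B) - (real (level x) * real (card W) / real q
    + (\<Sum>y\<in>W. real (level y)) / real q)"
    unfolding dev_def using finW
    by (simp add: sum_subtractf sum_of_bool_eq Collect_conj_eq add_divide_distrib sum.distrib sum_divide_distrib)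
  have "{u \<in> W. E x u} = ?B - {x}" using assms by (auto simp: E_def)
  then have "card ?B - 1 \<le> card {u \<in> W. E x u}" "card {u \<in> W. E x u} \<le> card ?B"
    using finW by (auto simp: card_Diff_singleton_if)
  then show ?thesis unfolding dev by auto
qed

text \<open>
  The expected degrees of consecutive layers differ by \<open>\<Delta> = |W| / q\<close>, so all layers but one
  reach degree \<open>d\<close> only through deviations of size at least \<open>\<Delta> / 2 - 1\<close>, which are rare by
  Chebyshev's inequality.
\<close>

lemma card_same_degree_le:
  assumes "W \<subseteq> V" "card V \<le> 2 * card W" "A \<subseteq> W" "\<And>x. x \<in> A \<Longrightarrow> card {u \<in> W. E x u} = d"
  shows "card A \<le> 17 * (r * q ^ 4)"
proof -
  define N where "N = r * q ^ 4"
  define \<Delta> where "\<Delta> = real (card W) / real q"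
  define \<delta> where "\<delta> = real d - (\<Sum>y\<in>W. real (level y)) / real q"
  \<comment> \<open>\<open>\<delta>\<close> is \<open>d\<close> without the layer-independent part
    of the mean degree, so layer \<open>l\<close> is near if its mean degree is within \<Delta>/2 of
    \<open>d\<close>.\<close>
  define near where "near l \<longleftrightarrow> \<bar>\<delta> - real l * \<Delta>\<bar> < \<Delta> / 2" for l
  have q2: "q \<ge> 2" using prime_q prime_ge_2_nat by blast
  have WMN: "real M * real N \<le> 2 * real (card W)"
    using assms(2) unfolding card_V N_def by (metis of_nat_le_iff of_nat_mult of_nat_numeral)
  have N_pos: "N > 0" using r_pos q_pos by (simp add: N_def)
  then have W_pos: "real (card W) > 0"
    using WMN M_pos by (metis mult_pos_pos of_nat_0_less_iff order_less_le_trans zero_less_mult_pos zero_less_numeral)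
  \<comment> \<open>This makes \<Delta>/2 - 1 at least \<Delta>/4.\<close>
  have \<Delta>4: "4 \<le> \<Delta>"
  proof -
    have "2 ^ 3 \<le> q ^ 3" using q2 by (intro power_mono) auto
    also have "q ^ 3 \<le> M * r * q ^ 3" using M_pos r_pos by simp
    finally have "8 \<le> M * r * q ^ 3" by simp
    then have "real 8 \<le> real (M * r * q ^ 3)" by (rule of_nat_mono)
    then have "8 * real q \<le> real (M * r * q ^ 3) * real q" by (intro mult_right_mono) simp_all
    also have "\<dots> = real M * real N" by (simp add: N_def power4_eq_xxxx power3_eq_cube)
    finally show ?thesis using WMN q_pos by (simp add: \<Delta>_def field_simps)
  qed
  have far: "real (card (A \<inter> layer l)) \<le> 32 * real (r * q ^ 3)" if l: "l < M" "\<not> near l" for l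
  proof -
    have large: "(\<Delta> / 4)\<^sup>2 \<le> (dev W l x)\<^sup>2" if x: "x \<in> A \<inter> layer l" for x
    proof -
      have "\<bar>\<delta> - real l * \<Delta> - dev W l x\<bar> \<le> 1"
        using degree_eq[OF assms(1), of x] assms(3,4) x level_layer[of x l]
        by (auto simp: \<delta>_def \<Delta>_def algebra_simps)
      then have "\<Delta> / 4 \<le> \<bar>dev W l x\<bar>" using l(2) \<Delta>4 unfolding near_def by linarith
      then show ?thesis using \<Delta>4 by (subst (2) power2_abs[symmetric]) (intro power_mono, auto)
    qed
    have "real (card (A \<inter> layer l)) * (\<Delta> / 4)\<^sup>2 = (\<Sum>x\<in>A \<inter> layer l. (\<Delta> / 4)\<^sup>2)" by simp
    also have "\<dots> \<le> (\<Sum>x\<in>A \<inter> layer l. (dev W l x)\<^sup>2)" by (intro sum_mono large)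
    also have "\<dots> \<le> (\<Sum>x\<in>layer l. (dev W l x)\<^sup>2)"
      using finite_layer by (intro sum_mono2) auto
    also have "\<dots> \<le> real (card W) * real (M * (r * q)) * real N"
      unfolding N_def by (rule sum_dev_squared_le[OF assms(1) l(1)])
    finally have "(real (card (A \<inter> layer l)) * real (card W)) * real (card W)
        \<le> (16 * real (r * q ^ 3) * (real M * real N)) * real (card W)"
      using q_pos by (simp add: \<Delta>_def power2_eq_square power3_eq_cube divide_simps ac_simps)
    then have "real (card (A \<inter> layer l)) * real (card W) \<le> 16 * real (r * q ^ 3) * (real M * real N)"
      using W_pos by (rule mult_right_le_imp_le)
    also have "\<dots> \<le> 16 * real (r * q ^ 3) * (2 * real (card W))"
      using WMN by (intro mult_left_mono) auto
    finally have "real (card (A \<inter> layer l)) * real (card W) \<le> (32 * real (r * q ^ 3)) * real (card W)"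
      by simp
    then show ?thesis using W_pos by (rule mult_right_le_imp_le)
  qed
  have layer_le: "card (A \<inter> layer l) \<le> N" for l
    unfolding N_def card_layer[of l, symmetric] using finite_layer by (intro card_mono) auto
  have each: "card (A \<inter> layer l) \<le> of_bool (near l) * N + 32 * (r * q ^ 3)" if "l < M" for l
  proof (cases "near l")
    case True
    then show ?thesis using layer_le[of l] by simp
  next
    case False
    then have "real (card (A \<inter> layer l)) \<le> real (32 * (r * q ^ 3))" using far[OF that] by simp
    then show ?thesis unfolding of_nat_le_iff using False by simp
  qed
  \<comment> \<open>Open intervals of radius \<Delta>/2 around distinct multiples of \<Delta> are
    disjoint.\<close>
  have near_unique: "l = l'" if "near l" "near l'" for l l'
  proof (rule ccontr)
    assume "l \<noteq> l'"
    then have "1 * \<Delta> \<le> \<bar>real l - real l'\<bar> * \<Delta>"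
      using \<Delta>4 by (intro mult_right_mono) linarith+
    also have "\<dots> = \<bar>real l * \<Delta> - real l' * \<Delta>\<bar>"
      using \<Delta>4 by (simp add: left_diff_distrib[symmetric] abs_mult)
    finally show False using that unfolding near_def by linarith
  qed
  have "card ({..<M} \<inter> {l. near l}) \<le> Suc 0"
    using near_unique by (subst card_le_Suc0_iff_eq) auto
  then have one: "(\<Sum>l<M. of_bool (near l) * N) \<le> N"
    by (simp add: sum_distrib_right[symmetric] sum_of_bool_eq)
  have "A = (\<Union>l<M. A \<inter> layer l)" using assms(1,3) V_eq_layers by auto
  then have "card A \<le> (\<Sum>l<M. card (A \<inter> layer l))"
    by (metis card_UN_le finite_lessThan)
  also have "\<dots> \<le> (\<Sum>l<M. of_bool (near l) * N + 32 * (r * q ^ 3))"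
    by (intro sum_mono each) simp
  also have "\<dots> \<le> N + M * (32 * (r * q ^ 3))" using one by (simp add: sum.distrib)
  \<comment> \<open>Since \<open>2 * M \<le> q\<close>, the far layers add up to at most
    \<open>16 * N\<close>; the near layer gives the seventeenth \<open>N\<close>.\<close>
  also have "M * (32 * (r * q ^ 3)) = (2 * M) * (16 * r * q ^ 3)" by simp
  also have "\<dots> \<le> q * (16 * r * q ^ 3)" using levels by (intro mult_right_mono) auto
  also have "\<dots> = 16 * N" by (simp add: N_def power4_eq_xxxx power3_eq_cube)
  finally show ?thesis by (simp add: N_def)
qed

section \<open>Choice of parameters and conclusion\<close>

text \<open>Otherwise \<open>W\<close> keeps half of \<open>V\<close>, and at most 17 layer sizes of
  vertices share a degree. Both \<open>k\<close> and \<open>card V - C\<close> exceed this, the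
  latter because \<open>34 < M\<close>.\<close>

lemma forces_repetition_lower:
  assumes "forces_repetition k C" "17 * (r * q ^ 4) < k" "34 < M"
  shows "int (M * (r * q ^ 4)) < 2 * C"
proof (rule ccontr)
  assume "\<not> int (M * (r * q ^ 4)) < 2 * C"
  then have C: "2 * C \<le> int (card V)" by (simp add: card_V)
  obtain W A d where W: "W \<subseteq> V" "A \<subseteq> W" "int (card W) \<ge> int (card V) - C"
      "int (card A) \<ge> min (int k) (int (card V) - C)" "\<And>v. v \<in> A \<Longrightarrow> card {u \<in> W. E v u} = d"
    by (rule forces_repetition_transfer[OF assms(1) simple_graph_E]) (rule that)
  have "card V \<le> 2 * card W" using W(3) C by linarith
  then have A: "card A \<le> 17 * (r * q ^ 4)" using card_same_degree_le[OF W(1) _ W(2,5)] by blast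
  define N where "N = r * q ^ 4"
  have "N > 0" using r_pos q_pos by (simp add: N_def)
  then have "34 * N < M * N" using assms(3) by simp
  then have "34 * N < card V" by (simp add: card_V N_def)
  then have "int (17 * N) < int (card V) - C" using C by linarith
  moreover have "int (17 * N) < int k" using assms(2) unfolding N_def of_nat_less_iff .
  moreover have "int (card A) \<le> int (17 * N)" using A unfolding N_def of_nat_le_iff .
  ultimately show False using W(4) by (simp add: min_def split: if_splits)
qed

end

text \<open>
  The prime \<open>q\<close> has to lie between constant multiples of \<open>ln k\<close> and \<open>k\<^sup>1\<^sup>/\<^sup>4\<close>; prime factors of Fermat
  numbers are available without any result on the distribution of primes.
\<close>

lemma forces_repetition_ge:
  assumes k: "2 ^ 560 \<le> k" and C: "forces_repetition k C"
  shows "real k * ln (real k) \<le> 3456 * real_of_int C"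
proof -
  have k_pos: "k \<ge> 1" by (rule order_trans[OF _ k]) (rule one_le_power, simp)
  obtain t where t: "2 ^ t \<le> k" "k < 2 ^ (t + 1)"
    using ex_power_ivl1[of 2 k] k_pos by auto
  \<comment> \<open>The exponent 560 = 8 * 70 leads to \<open>q > 70\<close> and thus to
    \<open>M > 34\<close>.\<close>
  have "(2::nat) ^ 560 < 2 ^ (t + 1)" using k t(2) by (rule order_le_less_trans)
  then have "560 < t + 1" by (rule power_less_imp_less_exp[rotated]) simp
  then have t560: "560 \<le> t" by simp
  then have "1 \<le> t div 8" by linarith
  \<comment> \<open>\<open>2 ^ s\<close> is t/8 up to a factor 2: large enough for
    \<open>q > t / 8\<close>, small enough that \<open>q ^ 4\<close> is at most 2^(t/2 + 4).\<close>
  then obtain s where s: "2 ^ s \<le> t div 8" "t div 8 < 2 ^ (s + 1)"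
    using ex_power_ivl1[of 2 "t div 8"] by auto
  obtain q :: nat where q: "prime q" "2 ^ (s + 1) < q" "q \<le> 2 ^ (2 ^ s) + 1"
    using fermat_number_prime_factor by blast
  have tq: "t < 8 * q" and q70: "70 < q" using s(2) q(2) t560 by linarith+
  have q_le: "18 * q ^ 4 \<le> k"
  proof -
    have "q \<le> 2 ^ (2 ^ s + 1)"
      using q(3) one_le_power[of "2::nat" "2 ^ s"] unfolding power_add power_one_right by linarith
    then have "q ^ 4 \<le> (2 ^ (2 ^ s + 1)) ^ 4" by (intro power_mono) auto
    then have "18 * q ^ 4 \<le> 2 ^ 5 * 2 ^ ((2 ^ s + 1) * 4)" unfolding power_mult by simp
    also have "\<dots> = 2 ^ (5 + (2 ^ s + 1) * 4)" by (simp only: power_add)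
    also have "\<dots> \<le> 2 ^ t"
    proof (intro power_increasing)
      have "8 * 2 ^ s \<le> t" using s(1) by linarith
      then show "5 + (2 ^ s + 1) * 4 \<le> t" using t560 unfolding add_mult_distrib by linarith
    qed simp
    finally show ?thesis using t(1) by linarith
  qed
  \<comment> \<open>The largest \<open>r\<close> with \<open>18 * r * q ^ 4 \<le> k\<close>; the
    layer size is then below k/17 and at least k/36.\<close>
  define r where "r = k div (18 * q ^ 4)"
  define M where "M = q div 2"
  have q4: "0 < q ^ 4" using q70 by simp
  have r_pos: "0 < r" unfolding r_def using q_le q4 by (simp add: div_greater_zero_iff)
  interpret layered_graph q r M
    using q(1) r_pos q70 by unfold_locales (auto simp: M_def)
  have "r * (18 * q ^ 4) \<le> k" unfolding r_def by simp
  moreover have "0 < r * q ^ 4" using r_pos q4 by simp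
  ultimately have "17 * (r * q ^ 4) < k" by linarith
  then have C1: "int (M * (r * q ^ 4)) < 2 * C"
    using forces_repetition_lower[OF C] q70 by (simp add: M_def)
  have kr: "real k \<le> 36 * real (r * q ^ 4)"
  proof -
    have "k < 18 * q ^ 4 + r * (18 * q ^ 4)"
      unfolding r_def using q4 by (simp add: dividend_less_div_times)
    moreover have "q ^ 4 \<le> r * q ^ 4" using r_pos by simp
    ultimately have "k \<le> 36 * (r * q ^ 4)" by linarith
    then have "real k \<le> real (36 * (r * q ^ 4))" by (rule of_nat_mono)
    then show ?thesis by simp
  qed
  have "real k \<le> real (2 ^ (t + 1))" using t(2) by (intro of_nat_mono less_imp_le)
  then have "ln (real k) \<le> ln (2 ^ (t + 1))" using k_pos by (subst ln_le_cancel_iff) auto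
  also have "\<dots> = real (t + 1) * ln 2" by (rule ln_realpow)
  also have "\<dots> \<le> real (t + 1) * 1" by (intro mult_left_mono) (use ln_2_less_1 in auto)
  also have "\<dots> \<le> 2 * real t" using t560 by simp
  also have "\<dots> \<le> 16 * real q" using tq by linarith
  \<comment> \<open>Rounding down in \<open>M = q div 2\<close> still leaves
    \<open>q \<le> 3 * M\<close>.\<close>
  also have "\<dots> \<le> 48 * real M" using q70 unfolding M_def by linarith
  finally have "ln (real k) \<le> 48 * real M" .
  with kr have "real k * ln (real k) \<le> (36 * real (r * q ^ 4)) * (48 * real M)"
    using k_pos by (intro mult_mono) auto
  \<comment> \<open>1728 = 36 * 48; the factor 2 in \<open>2 * C\<close> doubles it to 3456.\<close>
  also have "\<dots> = 1728 * real_of_int (int (M * (r * q ^ 4)))" by simp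
  also have "\<dots> \<le> 1728 * real_of_int (2 * C)" using C1 by (intro mult_left_mono) linarith+
  finally show ?thesis by simp
qed

theorem theorem5p2:
  "\<exists>c::real. c > 0 \<and>
     (\<forall>\<^sub>F k in sequentially. real_of_int (repetition_C k) \<ge> c * real k * ln (real k))"
proof (intro exI conjI)
  show "\<forall>\<^sub>F k in sequentially. real_of_int (repetition_C k) \<ge> 1 / 3456 * real k * ln (real k)"
    using eventually_ge_at_top[of "2 ^ 560 :: nat"]
  proof (rule eventually_mono)
    fix k :: nat
    assume "2 ^ 560 \<le> k"
    from forces_repetition_ge[OF this forces_repetition_C]
    show "real_of_int (repetition_C k) \<ge> 1 / 3456 * real k * ln (real k)" by simp
  qed
qed simp

end
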